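(* For every tree $T$, the ray space $\mathcal{R}(T)$ is ultraparacompact: every open cover of $\mathcal{R}(T)$ can be refined to an open partition of $\mathcal{R}(T)$ consisting of standard basic open sets.
   Context: A tree is a partially ordered set $T$ with a unique minimal element such that the set of predecessors of any element is well-ordered (distinct limit nodes may have the same set of strict predecessors). A path in $T$ is a nonempty down-closed chain; a ray is a path without maximal element. The ray space $\mathcal{R}(T)$ is the set of all rays of $T$ with the subspace topology inherited from $2^T$ (product topology), rays being identified with their characteristic functions. For $t\in T$, $[t]=\{x\in\mathcal{R}(T): t\in x\}$. A top of a ray $x$ is a node $s\in T$ whose set of strict predecessors $\{r\in T: r<s\}$ equals $x$. A standard basic open set of $\mathcal{R}(T)$ is a set of the form $[t,F]=[t]\setminus\bigcup_{s\in F}[s]$, where for some ray $x\in\mathcal{R}(T)$ we have $t\in x$ and $F$ is a finite (possibly empty) set of tops of $x$. *)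

theory Defs
  imports "HOL-Analysis.Analysis" "HOL-Library.Disjoint_Sets"
begin

text \<open>A tree is a carrier set \<open>T\<close> with a reflexive partial order \<open>r\<close>, where \<open>(s, t) \<in> r\<close> means
  \<open>s \<le> t\<close>; \<open>under r t\<close> and \<open>underS r t\<close> are the sets of weak and of strict predecessors of \<open>t\<close>.\<close>

definition tree_on :: "'a set \<Rightarrow> 'a rel \<Rightarrow> bool" where
  "tree_on T r \<longleftrightarrow>
     partial_order_on T r \<and>
     (\<exists>!m. m \<in> T \<and> (\<forall>s\<in>T. (s, m) \<in> r \<longrightarrow> s = m)) \<and>
     (\<forall>t\<in>T. well_order_on (underS r t) (Restr r (underS r t)))"

definition is_path :: "'a set \<Rightarrow> 'a rel \<Rightarrow> 'a set \<Rightarrow> bool" where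
  "is_path T r p \<longleftrightarrow> p \<subseteq> T \<and> p \<noteq> {} \<and> p \<in> Chains r \<and> (\<forall>t\<in>p. under r t \<subseteq> p)"

definition is_ray :: "'a set \<Rightarrow> 'a rel \<Rightarrow> 'a set \<Rightarrow> bool" where
  "is_ray T r x \<longleftrightarrow> is_path T r x \<and> \<not> (\<exists>m\<in>x. \<forall>s\<in>x. (m, s) \<in> r \<longrightarrow> s = m)"

definition rays :: "'a set \<Rightarrow> 'a rel \<Rightarrow> 'a set set" where
  "rays T r = {x. is_ray T r x}"

definition tops :: "'a set \<Rightarrow> 'a rel \<Rightarrow> 'a set \<Rightarrow> 'a set" where
  "tops T r x = {s \<in> T. underS r s = x}"

definition cantor_cube :: "'a set \<Rightarrow> ('a \<Rightarrow> bool) topology" where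
  "cantor_cube T = product_topology (\<lambda>_. discrete_topology UNIV) T"

text \<open>Points of \<open>product_topology\<close> over \<open>T\<close> are functions that are \<open>undefined\<close> outside \<open>T\<close>, hence the
  restriction.\<close>

definition char_fun :: "'a set \<Rightarrow> 'a set \<Rightarrow> 'a \<Rightarrow> bool" where
  "char_fun T x = restrict (\<lambda>t. t \<in> x) T"

text \<open>As \<open>char_fun T\<close> is injective on the rays, the pullback is the subspace topology inherited from
  the cube under the identification of a ray with its characteristic function.\<close>

definition ray_space :: "'a set \<Rightarrow> 'a rel \<Rightarrow> 'a set topology" where
  "ray_space T r = pullback_topology (rays T r) (char_fun T) (cantor_cube T)"

definition rays_through :: "'a set \<Rightarrow> 'a rel \<Rightarrow> 'a \<Rightarrow> 'a set set" where
  "rays_through T r t = {x \<in> rays T r. t \<in> x}"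

definition basic_set :: "'a set \<Rightarrow> 'a rel \<Rightarrow> 'a \<Rightarrow> 'a set \<Rightarrow> 'a set set" where
  "basic_set T r t F = rays_through T r t - (\<Union>s\<in>F. rays_through T r s)"

definition standard_basic_open :: "'a set \<Rightarrow> 'a rel \<Rightarrow> 'a set set \<Rightarrow> bool" where
  "standard_basic_open T r B \<longleftrightarrow>
     (\<exists>x\<in>rays T r. \<exists>t\<in>x. \<exists>F. finite F \<and> F \<subseteq> tops T r x \<and> B = basic_set T r t F)"

definition open_cover_of :: "'a topology \<Rightarrow> 'a set set \<Rightarrow> bool" where
  "open_cover_of X \<U> \<longleftrightarrow> (\<forall>U\<in>\<U>. openin X U) \<and> \<Union>\<U> = topspace X"

definition open_partition_of :: "'a topology \<Rightarrow> 'a set set \<Rightarrow> bool" where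
  "open_partition_of X \<V> \<longleftrightarrow> (\<forall>V\<in>\<V>. openin X V) \<and> partition_on (topspace X) \<V>"

definition refines_cover :: "'a set set \<Rightarrow> 'a set set \<Rightarrow> bool" where
  "refines_cover \<V> \<U> \<longleftrightarrow> (\<forall>V\<in>\<V>. \<exists>U\<in>\<U>. V \<subseteq> U)"

definition ultraparacompact_space :: "'a topology \<Rightarrow> bool" where
  "ultraparacompact_space X \<longleftrightarrow>
     (\<forall>\<U>. open_cover_of X \<U> \<longrightarrow> (\<exists>\<V>. open_partition_of X \<V> \<and> refines_cover \<V> \<U>))"

end

theory Submission
  imports Defs
begin

text \<open>Given an open cover and a node \<open>t\<close>, call a ray \<open>x\<close> through \<open>t\<close> coverable from \<open>t\<close> if some
  \<open>[t,F]\<close> with \<open>F\<close> a finite set of tops of \<open>x\<close> lies in a member of the cover. One can write \<open>[t]\<close> as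
  a disjoint union of standard sets that refine the cover and of sets \<open>[s]\<close>, \<open>s > t\<close>, that contain no
  ray coverable from \<open>t\<close>. Iterating this from the root, \<open>\<omega>\<close> many rounds exhaust all rays: a ray
  that is never covered yields nodes \<open>t\<^sub>0 < t\<^sub>1 < \<dots>\<close>; the ray \<open>p\<close> that they generate is coverable from
  some \<open>t\<^sub>j\<close>, yet it contains \<open>t\<^sub>j\<^sub>+\<^sub>1\<close>.\<close>

section \<open>Order theory of trees and their paths\<close>

locale order_tree =
  fixes T :: "'a set" and r :: "'a rel"
  assumes tree: "tree_on T r"
begin

lemma le_refl: "t \<in> T \<Longrightarrow> (t, t) \<in> r"
  and le_trans: "(s, t) \<in> r \<Longrightarrow> (t, u) \<in> r \<Longrightarrow> (s, u) \<in> r"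
  and le_antisym: "(s, t) \<in> r \<Longrightarrow> (t, s) \<in> r \<Longrightarrow> s = t"
  and le_in_tree: "(s, t) \<in> r \<Longrightarrow> s \<in> T \<and> t \<in> T"
proof -
  have po: "partial_order_on T r"
    using tree by (simp add: tree_on_def)
  note * = partial_order_onD[OF po]
  show "t \<in> T \<Longrightarrow> (t, t) \<in> r"
    using *(1) by (simp add: refl_on_def)
  show "(s, t) \<in> r \<Longrightarrow> (t, u) \<in> r \<Longrightarrow> (s, u) \<in> r"
    using *(2) by (rule transD)
  show "(s, t) \<in> r \<Longrightarrow> (t, s) \<in> r \<Longrightarrow> s = t"
    using *(3) by (rule antisymD)
  show "(s, t) \<in> r \<Longrightarrow> s \<in> T \<and> t \<in> T"
    using *(4) by blast
qed

lemma pred_linear: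
  assumes "t \<in> T" "a \<in> underS r t" "b \<in> underS r t"
  shows "(a, b) \<in> r \<or> (b, a) \<in> r"
proof -
  have "well_order_on (underS r t) (Restr r (underS r t))"
    using tree assms(1) by (simp add: tree_on_def)
  then have "total_on (underS r t) (Restr r (underS r t))"
    by (simp add: well_order_on_def linear_order_on_def)
  moreover have "a \<in> T"
    using assms(2) le_in_tree by (auto simp: underS_def)
  ultimately show ?thesis
    using assms(2,3) le_refl by (cases "a = b") (auto simp: total_on_def)
qed

lemma pred_least:
  assumes "t \<in> T" "Q \<subseteq> underS r t" "Q \<noteq> {}"
  shows "\<exists>q\<in>Q. \<forall>u\<in>Q. (q, u) \<in> r"
proof -
  have "well_order_on (underS r t) (Restr r (underS r t))"
    using tree assms(1) by (simp add: tree_on_def)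
  then have "wf (Restr r (underS r t) - Id)"
    by (simp add: well_order_on_def)
  then obtain q where q: "q \<in> Q" "\<And>u. (u, q) \<in> Restr r (underS r t) - Id \<Longrightarrow> u \<notin> Q"
    using assms(3) by (metis wfE_min all_not_in_conv)
  have "(q, u) \<in> r" if "u \<in> Q" for u
    using pred_linear[OF assms(1), of q u] q assms(2) that le_refl le_in_tree by blast
  then show ?thesis
    using q(1) by blast
qed

lemma pathD:
  assumes "is_path T r z"
  shows path_sub: "u \<in> z \<Longrightarrow> u \<in> T"
    and path_linear: "u \<in> z \<Longrightarrow> v \<in> z \<Longrightarrow> (u, v) \<in> r \<or> (v, u) \<in> r"
    and path_down: "u \<in> z \<Longrightarrow> (v, u) \<in> r \<Longrightarrow> v \<in> z"
  using assms by (auto simp: is_path_def Chains_def under_def)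

text \<open>Well-ordering is given only for predecessor sets, so fix some \<open>c\<close> in
  \<open>Q\<close>: by linearity of the path, either \<open>c\<close> itself is least, or the least
  element of \<open>Q\<close> strictly below \<open>c\<close> is least in all of
  \<open>Q\<close>.\<close>

lemma path_least:
  assumes z: "is_path T r z" and "Q \<subseteq> z" "Q \<noteq> {}"
  shows "\<exists>q\<in>Q. \<forall>u\<in>Q. (q, u) \<in> r"
proof -
  obtain c where c: "c \<in> Q"
    using assms(3) by blast
  then have cT: "c \<in> T"
    using assms(2) path_sub[OF z] by blast
  show ?thesis
  proof (cases "Q \<inter> underS r c = {}")
    case True
    have "(c, u) \<in> r" if "u \<in> Q" for u
      using path_linear[OF z, of c u] that True assms(2) c le_refl[OF cT]
      by (fastforce simp: underS_def)
    with c show ?thesis by blast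
  next
    case False
    then obtain q where q: "q \<in> Q \<inter> underS r c" "\<forall>u\<in>Q \<inter> underS r c. (q, u) \<in> r"
      using pred_least[OF cT, of "Q \<inter> underS r c"] by blast
    have "(q, u) \<in> r" if "u \<in> Q" for u
    proof (cases "u \<in> underS r c")
      case True
      then show ?thesis using q that by blast
    next
      case False
      then have "(c, u) \<in> r"
        using path_linear[OF z, of c u] that assms(2) c le_refl[OF cT]
        by (fastforce simp: underS_def)
      moreover have "(q, c) \<in> r"
        using q(1) by (simp add: underS_def)
      ultimately show ?thesis by (blast intro: le_trans)
    qed
    with q(1) show ?thesis by blast
  qed
qed

text \<open>Makes the path lemmas available for a single node \<open>k\<close>, notably
  \<open>top_exists\<close> with \<open>z = under r k\<close>.\<close>

lemma under_path:
  assumes t: "t \<in> T"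
  shows "is_path T r (under r t)"
proof -
  have "(a, b) \<in> r \<or> (b, a) \<in> r" if "(a, t) \<in> r" "(b, t) \<in> r" for a b
    using pred_linear[OF t, of a b] that by (cases "a = t \<or> b = t") (auto simp: underS_def)
  moreover have "under r t \<subseteq> T" "t \<in> under r t"
    using le_in_tree le_refl[OF t] by (auto simp: under_def)
  moreover have "under r u \<subseteq> under r t" if "(u, t) \<in> r" for u
    using le_trans that by (auto simp: under_def)
  ultimately show ?thesis
    by (auto simp: is_path_def Chains_def under_def)
qed

section \<open>Rays\<close>

lemma ray_path: "x \<in> rays T r \<Longrightarrow> is_path T r x"
  by (simp add: rays_def is_ray_def)

lemma ray_nonempty: "x \<in> rays T r \<Longrightarrow> x \<noteq> {}"
  by (simp add: rays_def is_ray_def is_path_def)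

lemmas ray_sub = path_sub[OF ray_path]
  and ray_linear = path_linear[OF ray_path]
  and ray_down = path_down[OF ray_path]

lemma ray_no_max: "x \<in> rays T r \<Longrightarrow> u \<in> x \<Longrightarrow> \<exists>v\<in>x. (u, v) \<in> r \<and> v \<noteq> u"
  by (auto simp: rays_def is_ray_def)

lemma rayI:
  assumes "\<And>u. u \<in> x \<Longrightarrow> u \<in> T" "x \<noteq> {}"
    "\<And>u v. u \<in> x \<Longrightarrow> v \<in> x \<Longrightarrow> (u, v) \<in> r \<or> (v, u) \<in> r"
    "\<And>u v. u \<in> x \<Longrightarrow> (v, u) \<in> r \<Longrightarrow> v \<in> x"
    "\<And>u. u \<in> x \<Longrightarrow> \<exists>v\<in>x. (u, v) \<in> r \<and> v \<noteq> u"
  shows "x \<in> rays T r"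
proof -
  have "is_path T r x"
    using assms(1-4) by (auto simp: is_path_def Chains_def under_def)
  moreover have "\<not> (\<exists>m\<in>x. \<forall>s\<in>x. (m, s) \<in> r \<longrightarrow> s = m)"
    using assms(5) by blast
  ultimately show ?thesis
    by (simp add: rays_def is_ray_def)
qed

lemma ray_upper:
  assumes "x \<in> rays T r" "t \<in> x" "u \<in> x"
  shows "\<exists>w\<in>x. (t, w) \<in> r \<and> (u, w) \<in> r"
  using ray_linear[OF assms] le_refl[OF ray_sub[OF assms(1)]] assms(2,3) by blast

text \<open>Rays are down-closed, so the least node of a ray is minimal in the whole tree, and the
  tree has only one minimal node.\<close>

lemma root_exists: "\<exists>m\<in>T. \<forall>x\<in>rays T r. m \<in> x"
proof -
  have "\<exists>!m. m \<in> T \<and> (\<forall>s\<in>T. (s, m) \<in> r \<longrightarrow> s = m)"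
    using tree by (simp add: tree_on_def)
  then obtain m where m: "m \<in> T"
    and uniq: "\<And>q. q \<in> T \<Longrightarrow> (\<forall>s\<in>T. (s, q) \<in> r \<longrightarrow> s = q) \<Longrightarrow> q = m"
    by metis
  have "m \<in> x" if x: "x \<in> rays T r" for x
  proof -
    obtain q where q: "q \<in> x" "\<forall>u\<in>x. (q, u) \<in> r"
      using path_least[OF ray_path[OF x] order_refl] ray_nonempty[OF x] by blast
    then have "q = m"
      by (intro uniq) (blast intro: ray_sub[OF x] ray_down[OF x] le_antisym)+
    with q(1) show ?thesis by simp
  qed
  with m show ?thesis by blast
qed

section \<open>Tops of rays\<close>

lemma topsD:
  assumes "s \<in> tops T r x"
  shows tops_in_tree: "s \<in> T" and tops_notin: "s \<notin> x"
    and tops_less: "u \<in> x \<Longrightarrow> (u, s) \<in> r"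
    and less_tops: "(u, s) \<in> r \<Longrightarrow> u \<noteq> s \<Longrightarrow> u \<in> x"
  using assms by (auto simp: tops_def underS_def)

lemma path_through_top:
  assumes "is_path T r z" "s \<in> z" "s \<in> tops T r x"
  shows "x \<subseteq> z"
  using assms path_down tops_less by blast

text \<open>The least node of \<open>z - x\<close> is the top: what lies strictly below it is in
  \<open>x\<close> by leastness, and all of \<open>x\<close> lies below it because \<open>z\<close>
  is linear and \<open>x\<close> is down-closed.\<close>

lemma top_exists:
  assumes x: "x \<in> rays T r" and z: "is_path T r z" and "x \<subseteq> z" "b \<in> z" "b \<notin> x"
  shows "\<exists>s\<in>z. s \<in> tops T r x \<and> (s, b) \<in> r"
proof -
  obtain s where s: "s \<in> z - x" "\<forall>u\<in>z - x. (s, u) \<in> r"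
    using path_least[OF z, of "z - x"] assms(4,5) by blast
  have "underS r s = x"
  proof (intro equalityI subsetI)
    fix u assume "u \<in> underS r s"
    then show "u \<in> x"
      using s path_down[OF z, of s u] le_antisym by (auto simp: underS_def)
  next
    fix u assume "u \<in> x"
    then show "u \<in> underS r s"
      using s path_linear[OF z, of s u] ray_down[OF x, of u s] assms(3)
      by (auto simp: underS_def)
  qed
  then have "s \<in> tops T r x"
    using s path_sub[OF z] by (simp add: tops_def)
  with s assms(4,5) show ?thesis by blast
qed

text \<open>Of two distinct comparable tops the smaller would be a strict predecessor of the larger
  and so lie on \<open>x\<close>, which no top does.\<close>

lemma tops_unique:
  assumes "is_path T r z" "s \<in> z" "s' \<in> z" "s \<in> tops T r x" "s' \<in> tops T r x"
  shows "s = s'"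
  using path_linear[OF assms(1-3)] less_tops tops_notin assms(4,5) by metis

section \<open>Standard basic sets and the topology of the ray space\<close>

lemma mem_through: "y \<in> rays_through T r t \<longleftrightarrow> y \<in> rays T r \<and> t \<in> y"
  by (auto simp: rays_through_def)

lemma mem_basic: "y \<in> basic_set T r t F \<longleftrightarrow> y \<in> rays T r \<and> t \<in> y \<and> F \<inter> y = {}"
  by (auto simp: basic_set_def rays_through_def)

text \<open>The ray \<open>x\<close> whose tops make up \<open>F\<close> belongs to
  \<open>[t,F]\<close>, as it avoids its own tops. This serves the requirement that a partition has
  no empty member.\<close>

lemma standard_nonempty: "standard_basic_open T r B \<Longrightarrow> B \<noteq> {}"
  unfolding standard_basic_open_def using mem_basic tops_notin by blast

lemma standard_basic:
  "x \<in> rays T r \<Longrightarrow> t \<in> x \<Longrightarrow> finite F \<Longrightarrow> F \<subseteq> tops T r x \<Longrightarrow>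
    standard_basic_open T r (basic_set T r t F)"
  unfolding standard_basic_open_def by blast

lemma standard_through:
  "x \<in> rays_through T r t \<Longrightarrow> standard_basic_open T r (rays_through T r t)"
  using standard_basic[of x t "{}"] by (simp add: mem_through basic_set_def)

lemma topspace_ray_space: "topspace (ray_space T r) = rays T r"
  by (auto simp: ray_space_def topspace_pullback_topology cantor_cube_def char_fun_def)

text \<open>\<open>[t]\<close> is the preimage of \<open>{True}\<close> under the projection to the
  discrete coordinate \<open>t\<close>.\<close>

lemma clopen_through:
  assumes "t \<in> T"
  shows "openin (ray_space T r) (rays_through T r t)"
    and "closedin (ray_space T r) (rays_through T r t)"
proof -
  have "continuous_map (ray_space T r) (discrete_topology UNIV) ((\<lambda>f. f t) \<circ> char_fun T)"
    unfolding ray_space_def cantor_cube_def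
    by (intro continuous_map_pullback continuous_map_product_projection assms)
  moreover have "rays_through T r t
      = {x \<in> topspace (ray_space T r). ((\<lambda>f. f t) \<circ> char_fun T) x \<in> {True}}"
    using assms by (auto simp: topspace_ray_space rays_through_def char_fun_def)
  ultimately show "openin (ray_space T r) (rays_through T r t)"
    "closedin (ray_space T r) (rays_through T r t)"
    by (simp_all only: openin_continuous_map_preimage closedin_continuous_map_preimage
        openin_discrete_topology closedin_discrete_topology subset_UNIV)
qed

lemma openin_standard:
  assumes "standard_basic_open T r B"
  shows "openin (ray_space T r) B"
proof -
  obtain x t F where x: "x \<in> rays T r" "t \<in> x" "finite F" "F \<subseteq> tops T r x"
    and B: "B = basic_set T r t F"
    using assms by (auto simp: standard_basic_open_def)
  have "closedin (ray_space T r) (\<Union>s\<in>F. rays_through T r s)"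
    using x(3,4) by (intro closedin_Union) (auto intro: clopen_through tops_in_tree)
  then show ?thesis
    unfolding B basic_set_def using x by (intro openin_diff clopen_through ray_sub)
qed

text \<open>Induction on \<open>K\<close>. A node \<open>k\<close> on \<open>x\<close> is forced by
  \<open>[k]\<close>; a node off \<open>x\<close> is excluded either by removing a top of
  \<open>x\<close> below it or by requiring a node of \<open>x\<close> incomparable to it.\<close>

lemma basic_set_determines:
  assumes x: "x \<in> rays T r" and "finite K" "K \<subseteq> T"
  shows "\<exists>t\<in>x. \<exists>F. finite F \<and> F \<subseteq> tops T r x \<and>
    (\<forall>y\<in>basic_set T r t F. \<forall>k\<in>K. k \<in> y \<longleftrightarrow> k \<in> x)"
  using assms(2,3)
proof (induction K)
  case empty
  then show ?case using ray_nonempty[OF x] by blast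
next
  case (insert k K)
  then obtain t F where t: "t \<in> x" "finite F" "F \<subseteq> tops T r x"
    and eq: "\<forall>y\<in>basic_set T r t F. \<forall>k\<in>K. k \<in> y \<longleftrightarrow> k \<in> x"
    by auto
  have kT: "k \<in> T"
    using insert.prems by simp
  have "\<exists>u\<in>x. \<exists>G. finite G \<and> G \<subseteq> tops T r x \<and> (\<forall>y\<in>basic_set T r u G. k \<in> y \<longleftrightarrow> k \<in> x)"
  proof (cases "k \<in> x")
    case True
    then show ?thesis
      by (intro bexI[of _ k] exI[of _ "{}"]) (auto simp: mem_basic)
  next
    case False
    show ?thesis
    proof (cases "x \<subseteq> under r k")
      case True
      moreover have "k \<in> under r k"
        using le_refl[OF kT] by (simp add: under_def)
      ultimately obtain s where s: "s \<in> tops T r x" "(s, k) \<in> r"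
        using top_exists[OF x under_path[OF kT]] False by blast
      \<comment> \<open>Every ray through \<open>k\<close> passes the top \<open>s\<close>, so
        removing \<open>[s]\<close> does all the work and \<open>u\<close> may be arbitrary.\<close>
      obtain u where "u \<in> x"
        using ray_nonempty[OF x] by blast
      then show ?thesis
        using s False
        by (intro bexI[of _ u] exI[of _ "{s}"]) (auto simp: mem_basic intro: ray_down)
    next
      case notsub: False
      then obtain u where u: "u \<in> x" "(u, k) \<notin> r"
        by (auto simp: under_def)
      \<comment> \<open>\<open>k\<close> below \<open>u\<close> would put \<open>k\<close> on
        \<open>x\<close>; so the two are incomparable and no ray contains both.\<close>
      have "k \<notin> y" if y: "y \<in> rays T r" "u \<in> y" for y
        using ray_linear[OF y(1), of u k] ray_down[OF x, of u k] u y(2) False by blast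
      with u(1) False show ?thesis
        by (intro bexI[of _ u] exI[of _ "{}"]) (auto simp: mem_basic)
    qed
  qed
  then obtain u G where u: "u \<in> x" "finite G" "G \<subseteq> tops T r x"
    and eq': "\<forall>y\<in>basic_set T r u G. k \<in> y \<longleftrightarrow> k \<in> x"
    by blast
  \<comment> \<open>Both conditions concern the same ray \<open>x\<close>: a common upper bound on
    \<open>x\<close> replaces the two nodes, and the two sets of tops can be united.\<close>
  obtain w where w: "w \<in> x" "(t, w) \<in> r" "(u, w) \<in> r"
    using ray_upper[OF x t(1) u(1)] by blast
  have "y \<in> basic_set T r t F \<and> y \<in> basic_set T r u G"
    if "y \<in> basic_set T r w (F \<union> G)" for y
    using that w ray_down by (auto simp: mem_basic)
  with eq eq' w(1) t(2,3) u(2,3) show ?case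
    by (intro bexI[of _ w] exI[of _ "F \<union> G"]) auto
qed

text \<open>A basic open box of the cube restricts only finitely many coordinates, and
  \<open>basic_set_determines\<close> makes all rays near \<open>x\<close> agree with
  \<open>x\<close> on them.\<close>

lemma standard_neighbourhood:
  assumes U: "openin (ray_space T r) U" and x: "x \<in> U"
  shows "\<exists>t\<in>x. \<exists>F. finite F \<and> F \<subseteq> tops T r x \<and> basic_set T r t F \<subseteq> U"
proof -
  obtain W where W: "openin (cantor_cube T) W" and UW: "U = char_fun T -` W \<inter> rays T r"
    using U by (auto simp: ray_space_def openin_pullback_topology)
  have "char_fun T x \<in> W" and xr: "x \<in> rays T r"
    using x UW by auto
  then obtain C where C: "finite {i \<in> T. C i \<noteq> UNIV}" "char_fun T x \<in> Pi\<^sub>E T C" "Pi\<^sub>E T C \<subseteq> W"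
    using W unfolding cantor_cube_def openin_product_topology_alt by auto
  obtain t F where tF: "t \<in> x" "finite F" "F \<subseteq> tops T r x"
    and eq: "\<forall>y\<in>basic_set T r t F. \<forall>k\<in>{i \<in> T. C i \<noteq> UNIV}. k \<in> y \<longleftrightarrow> k \<in> x"
    using basic_set_determines[OF xr C(1)] by auto
  have "y \<in> U" if y: "y \<in> basic_set T r t F" for y
  proof -
    have "char_fun T y i \<in> C i" if i: "i \<in> T" for i
    proof (cases "C i = UNIV")
      case False
      then have "i \<in> y \<longleftrightarrow> i \<in> x"
        using eq y i by blast
      then have "char_fun T y i = char_fun T x i"
        by (simp add: char_fun_def i)
      then show ?thesis using C(2) i by auto
    qed simp
    then have "char_fun T y \<in> Pi\<^sub>E T C"
      by (auto simp: char_fun_def)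
    with C(3) y show ?thesis
      by (auto simp: UW mem_basic)
  qed
  with tF show ?thesis by blast
qed

section \<open>Splitting \<open>[t]\<close> relative to a cover\<close>

definition coverable :: "'a set set set \<Rightarrow> 'a \<Rightarrow> 'a set set" where
  "coverable \<U> t = {x \<in> rays_through T r t.
     \<exists>F. finite F \<and> F \<subseteq> tops T r x \<and> (\<exists>U\<in>\<U>. basic_set T r t F \<subseteq> U)}"

text \<open>\<open>D\<close> holds the pieces settled in this round, \<open>S\<close> the nodes
  whose rays are passed on to the next one. The last clause keeps the sets \<open>[s]\<close>
  disjoint from each other and from the pieces; its condition on \<open>coverable\<close> is what
  makes \<open>\<omega>\<close> rounds suffice.\<close>

definition splitting :: "'a set set set \<Rightarrow> 'a \<Rightarrow> 'a set set set \<Rightarrow> 'a set \<Rightarrow> bool" where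
  "splitting \<U> t D S \<longleftrightarrow>
     (\<forall>B\<in>D. standard_basic_open T r B \<and> B \<subseteq> rays_through T r t \<and> (\<exists>U\<in>\<U>. B \<subseteq> U)) \<and>
     disjoint D \<and>
     (\<forall>s\<in>S. (t, s) \<in> r \<and> s \<noteq> t) \<and>
     (\<forall>y\<in>rays T r. t \<in> y \<longrightarrow> y \<in> \<Union>D \<or> (\<exists>s\<in>S. s \<in> y)) \<and>
     (\<forall>s\<in>S. \<forall>y\<in>rays T r. s \<in> y \<longrightarrow>
        y \<notin> \<Union>D \<and> y \<notin> coverable \<U> t \<and> (\<forall>s'\<in>S. s' \<in> y \<longrightarrow> s' = s))"

lemma splittingI:
  assumes "\<And>B. B \<in> D \<Longrightarrow> standard_basic_open T r B"
    and "\<And>B. B \<in> D \<Longrightarrow> B \<subseteq> rays_through T r t"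
    and "\<And>B. B \<in> D \<Longrightarrow> \<exists>U\<in>\<U>. B \<subseteq> U"
    and "disjoint D"
    and "\<And>s. s \<in> S \<Longrightarrow> (t, s) \<in> r \<and> s \<noteq> t"
    and "\<And>y. y \<in> rays T r \<Longrightarrow> t \<in> y \<Longrightarrow> y \<in> \<Union>D \<or> (\<exists>s\<in>S. s \<in> y)"
    and "\<And>s y. s \<in> S \<Longrightarrow> y \<in> rays T r \<Longrightarrow> s \<in> y \<Longrightarrow> y \<notin> \<Union>D"
    and "\<And>s y. s \<in> S \<Longrightarrow> y \<in> rays T r \<Longrightarrow> s \<in> y \<Longrightarrow> y \<notin> coverable \<U> t"
    and "\<And>s s' y. s \<in> S \<Longrightarrow> s' \<in> S \<Longrightarrow> y \<in> rays T r \<Longrightarrow> s \<in> y \<Longrightarrow> s' \<in> y \<Longrightarrow> s' = s"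
  shows "splitting \<U> t D S"
  unfolding splitting_def
  apply (intro conjI ballI impI)
          apply (erule assms(1))
         apply (erule assms(2))
        apply (erule assms(3))
       apply (rule assms(4))
      apply (erule assms(5)[THEN conjunct1])
     apply (erule assms(5)[THEN conjunct2])
    apply (erule (1) assms(6))
   apply (erule (2) assms(7))
  apply (erule (2) assms(8))
  apply (erule (4) assms(9)[rotated -1])
  done

lemma splittingD:
  assumes "splitting \<U> t D S"
  shows "B \<in> D \<Longrightarrow> standard_basic_open T r B"
    and "B \<in> D \<Longrightarrow> B \<subseteq> rays_through T r t"
    and "B \<in> D \<Longrightarrow> \<exists>U\<in>\<U>. B \<subseteq> U"
    and "disjoint D"
    and "s \<in> S \<Longrightarrow> (t, s) \<in> r \<and> s \<noteq> t"
    and "y \<in> rays T r \<Longrightarrow> t \<in> y \<Longrightarrow> y \<notin> \<Union>D \<Longrightarrow> \<exists>s\<in>S. s \<in> y"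
    and "s \<in> S \<Longrightarrow> y \<in> rays T r \<Longrightarrow> s \<in> y \<Longrightarrow> y \<notin> \<Union>D"
    and "s \<in> S \<Longrightarrow> y \<in> rays T r \<Longrightarrow> s \<in> y \<Longrightarrow> y \<notin> coverable \<U> t"
    and "s \<in> S \<Longrightarrow> s' \<in> S \<Longrightarrow> y \<in> rays T r \<Longrightarrow> s \<in> y \<Longrightarrow> s' \<in> y \<Longrightarrow> s' = s"
proof -
  note c1 = assms[unfolded splitting_def]
  note c2 = c1[THEN conjunct2] note c3 = c2[THEN conjunct2]
  note c4 = c3[THEN conjunct2] note c5 = c4[THEN conjunct2]
  show "B \<in> D \<Longrightarrow> standard_basic_open T r B" "B \<in> D \<Longrightarrow> B \<subseteq> rays_through T r t"
    "B \<in> D \<Longrightarrow> \<exists>U\<in>\<U>. B \<subseteq> U"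
    using c1[THEN conjunct1] by blast+
  show "disjoint D"
    using c2 by (rule conjunct1)
  show "s \<in> S \<Longrightarrow> (t, s) \<in> r \<and> s \<noteq> t"
    using c3[THEN conjunct1] by blast
  show "y \<in> rays T r \<Longrightarrow> t \<in> y \<Longrightarrow> y \<notin> \<Union>D \<Longrightarrow> \<exists>s\<in>S. s \<in> y"
    using c4[THEN conjunct1, rule_format, of y] by simp
  show "s \<in> S \<Longrightarrow> y \<in> rays T r \<Longrightarrow> s \<in> y \<Longrightarrow> y \<notin> \<Union>D"
    "s \<in> S \<Longrightarrow> y \<in> rays T r \<Longrightarrow> s \<in> y \<Longrightarrow> y \<notin> coverable \<U> t"
    "s \<in> S \<Longrightarrow> s' \<in> S \<Longrightarrow> y \<in> rays T r \<Longrightarrow> s \<in> y \<Longrightarrow> s' \<in> y \<Longrightarrow> s' = s"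
    using c5[THEN bspec, THEN bspec, THEN mp, of s y] by simp_all
qed

text \<open>Nothing can be settled at \<open>t\<close>, so all rays are passed on to the immediate
  successors of \<open>t\<close>. A ray through \<open>t\<close> has a node beyond \<open>t\<close>,
  hence a least one, and by linearity contains no other successor.\<close>

lemma splitting_successors:
  assumes "coverable \<U> t = {}"
  shows "splitting \<U> t {} {s. (t, s) \<in> r \<and> s \<noteq> t \<and> (\<forall>u. (t, u) \<in> r \<and> u \<noteq> t \<and> (u, s) \<in> r \<longrightarrow> u = s)}"
    (is "splitting \<U> t {} ?S")
proof (rule splittingI)
  show "y \<in> \<Union>{} \<or> (\<exists>s\<in>?S. s \<in> y)" if y: "y \<in> rays T r" "t \<in> y" for y
  proof -
    let ?Q = "{u \<in> y. (t, u) \<in> r \<and> u \<noteq> t}"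
    obtain s where s: "s \<in> ?Q" "\<forall>u\<in>?Q. (s, u) \<in> r"
      using path_least[OF ray_path[OF y(1)], of ?Q] ray_no_max[OF y] by blast
    then have "u = s" if "(t, u) \<in> r" "u \<noteq> t" "(u, s) \<in> r" for u
      using that ray_down[OF y(1), of s u] le_antisym by blast
    with s show ?thesis by blast
  qed
  show "s' = s" if "s \<in> ?S" "s' \<in> ?S" "y \<in> rays T r" "s \<in> y" "s' \<in> y" for y s s'
    using ray_linear[of y s s'] that by blast
qed (use assms in auto)

text \<open>A ray through a top \<open>s\<close> of \<open>x\<close> properly contains
  \<open>x\<close>, so maximality makes it not coverable; and no ray contains two tops of
  \<open>x\<close>.\<close>

lemma splitting_maximal:
  assumes x: "x \<in> rays T r" "t \<in> x" "finite F" "F \<subseteq> tops T r x" "U \<in> \<U>" "basic_set T r t F \<subseteq> U"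
    and max: "\<And>y. y \<in> coverable \<U> t \<Longrightarrow> x \<subseteq> y \<Longrightarrow> y = x"
  shows "splitting \<U> t {basic_set T r t F} F"
proof (rule splittingI)
  show "y \<notin> coverable \<U> t" if "s \<in> F" "y \<in> rays T r" "s \<in> y" for s y
    using max[of y] path_through_top[OF ray_path[OF that(2)] that(3), of x] tops_notin that x(4)
    by blast
  show "s' = s" if "s \<in> F" "s' \<in> F" "y \<in> rays T r" "s \<in> y" "s' \<in> y" for s s' y
    using tops_unique[OF ray_path[OF that(3)] that(5,4)] that x(4) by blast
  show "(t, s) \<in> r \<and> s \<noteq> t" if "s \<in> F" for s
    using that x(2,4) tops_less tops_notin by blast
qed (use x standard_basic[OF x(1-4)] in \<open>auto simp: mem_basic mem_through\<close>)

lemma Union_chain_ray: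
  assumes C: "subset.chain (rays T r) C" "C \<noteq> {}"
  shows "\<Union>C \<in> rays T r"
proof (rule rayI)
  have r: "x \<in> rays T r" if "x \<in> C" for x
    using C(1) that by (auto simp: subset_chain_def)
  show "\<Union>C \<noteq> {}"
    using C(2) r ray_nonempty by blast
  show "(u, v) \<in> r \<or> (v, u) \<in> r" if uv: "u \<in> \<Union>C" "v \<in> \<Union>C" for u v
  proof -
    obtain x y where xy: "x \<in> C" "y \<in> C" "u \<in> x" "v \<in> y"
      using uv by blast
    then have "x \<subseteq> y \<or> y \<subseteq> x"
      using C(1) by (auto simp: subset_chain_def)
    with xy obtain z where "z \<in> C" "u \<in> z" "v \<in> z"
      by blast
    then show ?thesis
      using r ray_linear by blast
  qed
  show "u \<in> T" if "u \<in> \<Union>C" for u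
    using that r ray_sub by blast
  show "v \<in> \<Union>C" if "u \<in> \<Union>C" "(v, u) \<in> r" for u v
    using that r ray_down by blast
  show "\<exists>v\<in>\<Union>C. (u, v) \<in> r \<and> v \<noteq> u" if "u \<in> \<Union>C" for u
    using that r ray_no_max by blast
qed

text \<open>If the rays coverable from \<open>t\<close> contain a chain \<open>C\<close> unbounded among them, put \<open>p = \<Union>C\<close>, choose
  \<open>[u,F\<^sub>p]\<close> around \<open>p\<close> inside a cover member and \<open>x \<subset> y\<close> in \<open>C\<close> with \<open>u \<in> x\<close>, and let \<open>s\<^sub>0\<close> be the top of
  \<open>x\<close> in \<open>y\<close>. Then \<open>[t,F\<^sub>x \<union> {s\<^sub>0}]\<close>, \<open>[s\<^sub>0,F\<^sub>p]\<close> and the \<open>[s]\<close> with \<open>s \<in> F\<^sub>x - {s\<^sub>0}\<close>, which lie in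
  \<open>[t,F\<^sub>y]\<close>, leave only the \<open>[s]\<close> with \<open>s \<in> F\<^sub>p\<close>; all rays in these contain \<open>p\<close>.\<close>

lemma splitting_unbounded:
  assumes cover: "open_cover_of (ray_space T r) \<U>"
    and chain: "subset.chain (coverable \<U> t) C" and ne: "C \<noteq> {}"
    and unb: "\<And>y. y \<in> coverable \<U> t \<Longrightarrow> \<not> \<Union>C \<subseteq> y"
  shows "\<exists>D S. splitting \<U> t D S"
proof -
  have CA: "x \<in> coverable \<U> t" if "x \<in> C" for x
    using chain that by (auto simp: subset_chain_def)
  have Cr: "x \<in> rays T r" "t \<in> x" if "x \<in> C" for x
    using CA[OF that] by (auto simp: coverable_def rays_through_def)
  have chain_r: "subset.chain (rays T r) C"
    using chain Cr by (auto simp: subset_chain_def)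
  define p where "p = \<Union>C"
  have p: "p \<in> rays T r"
    unfolding p_def by (rule Union_chain_ray[OF chain_r ne])
  then obtain U where U: "U \<in> \<U>" "openin (ray_space T r) U" "p \<in> U"
    using cover by (auto simp: open_cover_of_def topspace_ray_space)
  obtain u Fp where u: "u \<in> p" and Fp: "finite Fp" "Fp \<subseteq> tops T r p" "basic_set T r u Fp \<subseteq> U"
    using standard_neighbourhood[OF U(2,3)] by blast
  obtain x where x: "x \<in> C" "u \<in> x"
    using u by (auto simp: p_def)
  obtain y where y: "y \<in> C" "\<not> y \<subseteq> x"
    using unb[OF CA[OF x(1)]] by blast
  have xy: "x \<subseteq> y"
    using chain x y by (auto simp: subset_chain_def)
  obtain s0 where s0: "s0 \<in> y" "s0 \<in> tops T r x"
    using top_exists[OF Cr(1)[OF x(1)] ray_path[OF Cr(1)[OF y(1)]] xy] y(2) by blast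
  \<comment> \<open>Since \<open>s0\<close> lies on \<open>p\<close> and \<open>Fp\<close> consists
    of tops of \<open>p\<close>, the set \<open>[s0,Fp]\<close> is standard, with \<open>p\<close>
    as its witness.\<close>
  have s0p: "s0 \<in> p"
    using s0(1) y(1) by (auto simp: p_def)
  obtain F U0 where F: "finite F" "F \<subseteq> tops T r x" and U0: "U0 \<in> \<U>" "basic_set T r t F \<subseteq> U0"
    using CA[OF x(1)] by (auto simp: coverable_def)
  obtain G U1 where G: "finite G" "G \<subseteq> tops T r y" and U1: "U1 \<in> \<U>" "basic_set T r t G \<subseteq> U1"
    using CA[OF y(1)] by (auto simp: coverable_def)
  define B0 where "B0 = basic_set T r t (insert s0 F)"
  define B1 where "B1 = basic_set T r s0 Fp"
  \<comment> \<open>Empty \<open>[s]\<close> are dropped, since a standard set needs a ray through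
    its node.\<close>
  define E where "E = {rays_through T r s | s. s \<in> F - {s0} \<and> rays_through T r s \<noteq> {}}"
  have tx: "t \<in> x" and xr: "x \<in> rays T r"
    using Cr x(1) by auto
  have F0: "insert s0 F \<subseteq> tops T r x"
    using F(2) s0(2) by simp
  have through_x: "x \<subseteq> z" if "z \<in> rays T r" "s \<in> z" "s \<in> insert s0 F" for z s
    using path_through_top[OF ray_path[OF that(1)] that(2)] that(3) F0 by blast
  have through_p: "p \<subseteq> z" if "z \<in> rays T r" "s \<in> z" "s \<in> Fp" for z s
    using path_through_top[OF ray_path[OF that(1)] that(2)] that(3) Fp(2) by blast
  have uniq: "s = s'" if "z \<in> rays T r" "s \<in> z" "s' \<in> z" "s \<in> insert s0 F" "s' \<in> insert s0 F"
    for z s s'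
    using tops_unique[OF ray_path[OF that(1)] that(2,3)] that(4,5) F0 by blast
  \<comment> \<open>This is why \<open>x\<close> was chosen to contain \<open>u\<close>: it yields
    \<open>[s0,Fp] \<subseteq> [u,Fp] \<subseteq> U\<close>.\<close>
  have us0: "(u, s0) \<in> r"
    using tops_less[OF s0(2) x(2)] .
  have B0: "standard_basic_open T r B0" "B0 \<subseteq> rays_through T r t" "\<exists>U\<in>\<U>. B0 \<subseteq> U"
  proof -
    show "standard_basic_open T r B0"
      unfolding B0_def using standard_basic[OF xr tx] F(1) F0 by blast
    show "B0 \<subseteq> rays_through T r t"
      by (auto simp: B0_def mem_basic mem_through)
    have "B0 \<subseteq> U0"
      using U0(2) by (auto simp: B0_def mem_basic subset_iff)
    with U0(1) show "\<exists>U\<in>\<U>. B0 \<subseteq> U" by blast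
  qed
  have B1: "standard_basic_open T r B1" "B1 \<subseteq> rays_through T r t" "\<exists>U\<in>\<U>. B1 \<subseteq> U"
  proof -
    show "standard_basic_open T r B1"
      unfolding B1_def using standard_basic[OF p s0p Fp(1,2)] .
    show "B1 \<subseteq> rays_through T r t"
      using through_x[THEN subsetD, OF _ _ _ tx] by (auto simp: B1_def mem_basic mem_through)
    have "B1 \<subseteq> U"
      using Fp(3) us0 ray_down by (auto simp: B1_def mem_basic subset_iff)
    with U(1) show "\<exists>U\<in>\<U>. B1 \<subseteq> U" by blast
  qed
  have E: "standard_basic_open T r B" "B \<subseteq> rays_through T r t" "\<exists>U\<in>\<U>. B \<subseteq> U" if BE: "B \<in> E" for B
  proof -
    obtain s where s: "s \<in> F" "s \<noteq> s0" and B: "B = rays_through T r s" "B \<noteq> {}"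
      using BE by (auto simp: E_def)
    show "standard_basic_open T r B"
      using B standard_through by blast
    show Bt: "B \<subseteq> rays_through T r t"
      using B(1) through_x[THEN subsetD, OF _ _ _ tx] s(1) by (auto simp: mem_through)
    txt \<open>A ray through \<open>s\<close> that met \<open>G\<close> would contain \<open>y\<close> and hence the second top \<open>s0\<close> of \<open>x\<close>.\<close>
    have "g \<notin> z" if z: "z \<in> B" and g: "g \<in> G" for z g
    proof
      assume "g \<in> z"
      moreover have zr: "z \<in> rays T r" "s \<in> z"
        using z B(1) by (auto simp: mem_through)
      ultimately have "s0 \<in> z"
        using path_through_top[OF ray_path[OF zr(1)]] g G(2) s0(1) by blast
      then show False
        using uniq[OF zr(1), of s s0] zr(2) s by blast
    qed
    then have "B \<subseteq> basic_set T r t G"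
      using Bt unfolding subset_iff mem_basic mem_through by blast
    with U1 show "\<exists>U\<in>\<U>. B \<subseteq> U" by blast
  qed
  have B01: "B0 \<inter> B1 = {}"
    by (auto simp: B0_def B1_def mem_basic)
  have B0E: "B0 \<inter> B = {}" "B1 \<inter> B = {}" if "B \<in> E" for B
    using that uniq by (auto simp: B0_def B1_def E_def mem_basic mem_through)
  have disjE: "disjoint E"
  proof (rule disjointI)
    fix A B assume "A \<in> E" "B \<in> E" "A \<noteq> B"
    then obtain s s' where "s \<in> F" "s' \<in> F" "s \<noteq> s'"
      and AB: "A = rays_through T r s" "B = rays_through T r s'"
      by (auto simp: E_def)
    then show "A \<inter> B = {}"
      using uniq[of _ s s'] unfolding AB by (auto simp: mem_through)
  qed
  have "splitting \<U> t (insert B0 (insert B1 E)) Fp"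
  proof (rule splittingI)
    fix B assume B: "B \<in> insert B0 (insert B1 E)"
    show "standard_basic_open T r B"
      using B B0(1) B1(1) E(1) by (elim insertE) simp_all
    show "B \<subseteq> rays_through T r t"
      using B B0(2) B1(2) E(2) by (elim insertE) simp_all
    show "\<exists>U\<in>\<U>. B \<subseteq> U"
      using B B0(3) B1(3) E(3) by (elim insertE) simp_all
  next
    show "disjoint (insert B0 (insert B1 E))"
      using disjE B01 B0E by (auto simp: pairwise_insert disjnt_def Int_commute)
    have "t \<in> p"
      using tx x(1) by (auto simp: p_def)
    then show "(t, s) \<in> r \<and> s \<noteq> t" if "s \<in> Fp" for s
      using that Fp(2) tops_less tops_notin by blast
  next
    fix z assume z: "z \<in> rays T r" "t \<in> z"
    consider "insert s0 F \<inter> z = {}" | "s0 \<in> z" | s where "s \<in> F - {s0}" "s \<in> z"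
      by blast
    then show "z \<in> \<Union>(insert B0 (insert B1 E)) \<or> (\<exists>s\<in>Fp. s \<in> z)"
    proof cases
      case 1
      with z have "z \<in> B0" by (simp add: B0_def mem_basic)
      then show ?thesis by blast
    next
      case 2
      with z have "z \<in> B1 \<or> (\<exists>s\<in>Fp. s \<in> z)" by (auto simp: B1_def mem_basic)
      then show ?thesis by blast
    next
      case 3
      with z have "z \<in> rays_through T r s" by (simp add: mem_through)
      with 3 have "rays_through T r s \<in> E" by (auto simp: E_def)
      with \<open>z \<in> rays_through T r s\<close> show ?thesis by blast
    qed
  next
    fix s z assume s: "s \<in> Fp" and z: "z \<in> rays T r" "s \<in> z"
    \<comment> \<open>Containing \<open>p\<close>, the ray \<open>z\<close> contains
      \<open>s0\<close>: this bars it from \<open>B0\<close> and, by uniqueness of tops of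
      \<open>x\<close>, from the members of \<open>E\<close>. It avoids \<open>B1\<close> because
      \<open>s\<close> is in \<open>Fp\<close>.\<close>
    have pz: "p \<subseteq> z"
      using through_p z s by blast
    then have s0z: "s0 \<in> z"
      using s0p by blast
    have "z \<notin> B0" "z \<notin> B1"
      using s0z s z by (auto simp: B0_def B1_def mem_basic)
    moreover have "z \<notin> B" if "B \<in> E" for B
      using that uniq[OF z(1) _ s0z] by (auto simp: E_def mem_through)
    ultimately show "z \<notin> \<Union>(insert B0 (insert B1 E))"
      by blast
    show "z \<notin> coverable \<U> t"
      using unb pz by (auto simp: p_def)
    show "s' = s" if "s' \<in> Fp" "s' \<in> z" for s'
      using tops_unique[OF ray_path[OF z(1)] that(2) z(2)] that(1) s Fp(2) by blast
  qed
  then show ?thesis by blast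
qed

text \<open>Three cases: no coverable ray, a maximal one, or none maximal. In the last case the
  contrapositive of Zorn's lemma supplies a chain without upper bound, nonempty because some
  coverable ray exists.\<close>

lemma splitting_exists:
  assumes cover: "open_cover_of (ray_space T r) \<U>"
  shows "\<exists>D S. splitting \<U> t D S"
proof (cases "coverable \<U> t = {}")
  case True
  then show ?thesis using splitting_successors by blast
next
  case False
  show ?thesis
  proof (cases "\<exists>x\<in>coverable \<U> t. \<forall>y\<in>coverable \<U> t. x \<subseteq> y \<longrightarrow> y = x")
    case True
    then obtain x where x: "x \<in> coverable \<U> t" "\<And>y. y \<in> coverable \<U> t \<Longrightarrow> x \<subseteq> y \<Longrightarrow> y = x"
      by blast
    then obtain F U where "x \<in> rays T r" "t \<in> x" "finite F" "F \<subseteq> tops T r x" "U \<in> \<U>"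
        "basic_set T r t F \<subseteq> U"
      by (auto simp: coverable_def rays_through_def)
    then show ?thesis
      using splitting_maximal x(2) by blast
  next
    case nomax: False
    then obtain C where C: "subset.chain (coverable \<U> t) C"
      and unb: "\<not> (\<exists>y\<in>coverable \<U> t. \<forall>x\<in>C. x \<subseteq> y)"
      using subset_Zorn[of "coverable \<U> t"] by blast
    have "C \<noteq> {}"
      using unb False by blast
    then show ?thesis
      using splitting_unbounded[OF cover C] unb by blast
  qed
qed

section \<open>Iterating the splittings from the root\<close>

theorem standard_refinement:
  assumes cover: "open_cover_of (ray_space T r) \<U>"
  shows "\<exists>\<V>. open_partition_of (ray_space T r) \<V> \<and> refines_cover \<V> \<U> \<and>
    (\<forall>V\<in>\<V>. standard_basic_open T r V)"
proof -
  obtain D S where split: "\<And>t. splitting \<U> t (D t) (S t)"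
    using splitting_exists[OF cover] by metis
  note spl = splittingD[OF split]
  obtain m where m: "m \<in> T" "\<And>x. x \<in> rays T r \<Longrightarrow> m \<in> x"
    using root_exists by blast
  \<comment> \<open>\<open>R\<close> leads from a node to those of the next round, so
    \<open>N\<close> collects the nodes of all finite rounds.\<close>
  define R where "R = {(t, s). s \<in> S t}"
  define N where "N = {t. (m, t) \<in> R\<^sup>*}"
  define \<V> where "\<V> = (\<Union>t\<in>N. D t)"
  have R_le: "(s, t) \<in> r" if "(s, t) \<in> R\<^sup>*" "t \<in> T" for s t
    using that
  proof (induction rule: converse_rtrancl_induct)
    case base
    then show ?case by (rule le_refl)
  next
    case (step a b)
    then have "(a, b) \<in> r"
      using spl(5) by (simp add: R_def)
    with step show ?case by (blast intro: le_trans)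
  qed
  have std: "standard_basic_open T r V" if "V \<in> \<V>" for V
    using that spl(1) by (auto simp: \<V>_def)
  have covered: "y \<in> \<Union>\<V>" if y: "y \<in> rays T r" for y
  proof (rule ccontr)
    assume unc: "y \<notin> \<Union>\<V>"
    have "\<exists>f. \<forall>n::nat. (f n \<in> N \<and> f n \<in> y) \<and> f (Suc n) \<in> S (f n)"
    proof (rule dependent_nat_choice)
      show "\<exists>t. t \<in> N \<and> t \<in> y"
        using m(2)[OF y] by (auto simp: N_def)
      show "\<exists>s. (s \<in> N \<and> s \<in> y) \<and> s \<in> S t" if t: "t \<in> N \<and> t \<in> y" for t and n :: nat
      proof -
        have nD: "y \<notin> \<Union>(D t)"
          using unc t by (auto simp: \<V>_def)
        obtain s where s: "s \<in> S t" "s \<in> y"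
          using spl(6)[OF y conjunct2[OF t] nD] by blast
        then have "s \<in> N"
          using t by (auto simp: N_def R_def intro: rtrancl_into_rtrancl)
        with s show ?thesis by blast
      qed
    qed
    then obtain f where f: "\<And>n. f n \<in> y" "\<And>n. f (Suc n) \<in> S (f n)"
      by blast
    have f_less: "(f n, f (Suc n)) \<in> r \<and> f (Suc n) \<noteq> f n" for n
      using spl(5)[OF f(2)] .
    \<comment> \<open>The down-closure of the sequence has no maximal node because the
      \<open>f n\<close> increase strictly; it may be a proper part of \<open>y\<close>.\<close>
    define p where "p = {u. \<exists>n. (u, f n) \<in> r}"
    have fp: "f n \<in> p" for n
      using f_less by (auto simp: p_def)
    have p_sub: "p \<subseteq> y"
      using ray_down[OF y] f(1) by (auto simp: p_def)
    have p: "p \<in> rays T r"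
    proof (rule rayI)
      show "\<exists>v\<in>p. (u, v) \<in> r \<and> v \<noteq> u" if u: "u \<in> p" for u
      proof -
        obtain n where n: "(u, f n) \<in> r"
          using u by (auto simp: p_def)
        then have "(u, f (Suc n)) \<in> r" "f (Suc n) \<noteq> u"
          using f_less[of n] le_trans le_antisym by blast+
        with fp show ?thesis by blast
      qed
      show "v \<in> p" if "u \<in> p" "(v, u) \<in> r" for u v
        using that le_trans by (auto simp: p_def)
    qed (use p_sub fp ray_sub[OF y] ray_linear[OF y] in blast)+
    then obtain U where U: "U \<in> \<U>" "openin (ray_space T r) U" "p \<in> U"
      using cover by (auto simp: open_cover_of_def topspace_ray_space)
    obtain t F where t: "t \<in> p" and F: "finite F" "F \<subseteq> tops T r p" "basic_set T r t F \<subseteq> U"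
      using standard_neighbourhood[OF U(2,3)] by blast
    obtain n where n: "(t, f n) \<in> r"
      using t by (auto simp: p_def)
    \<comment> \<open>Going up from \<open>t\<close> to \<open>f n\<close> only shrinks the set, so
      \<open>p\<close> is coverable from \<open>f n\<close>; but \<open>p\<close> contains
      \<open>f (Suc n)\<close>, a node of \<open>S (f n)\<close>.\<close>
    have "basic_set T r (f n) F \<subseteq> U"
      using F(3) n ray_down by (auto simp: mem_basic subset_iff)
    then have "p \<in> coverable \<U> (f n)"
      using p fp F U(1) by (auto simp: coverable_def mem_through)
    then show False
      using spl(8)[OF f(2) p fp] by blast
  qed
  \<comment> \<open>Along a fixed ray the \<open>R\<close>-path from the root is deterministic: two
    \<open>R\<close>-successors of \<open>a\<close> that both lie on \<open>y\<close>
    coincide.\<close>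
  have comparable: "(t, t') \<in> R\<^sup>* \<or> (t', t) \<in> R\<^sup>*"
    if y: "y \<in> rays T r" and "t \<in> N" "t' \<in> N" "t \<in> y" "t' \<in> y" for y t t'
  proof -
    have "(m, t) \<in> R\<^sup>*"
      using \<open>t \<in> N\<close> by (simp add: N_def)
    then show ?thesis using \<open>t \<in> y\<close>
    proof (induction rule: rtrancl_induct)
      case base
      then show ?case using \<open>t' \<in> N\<close> by (simp add: N_def)
    next
      case (step a b)
      have ab: "b \<in> S a" and "(a, b) \<in> r"
        using step.hyps(2) spl(5) by (auto simp: R_def)
      then have "(a, t') \<in> R\<^sup>* \<or> (t', a) \<in> R\<^sup>*"
        using step.IH step.prems ray_down[OF y] by blast
      then show ?case
      proof
        assume "(a, t') \<in> R\<^sup>*"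
        then show ?thesis
        proof (cases rule: converse_rtranclE)
          case base
          then show ?thesis using step.hyps(2) by blast
        next
          case (step c)
          have "c \<in> y"
            using R_le[OF step(2)] ray_sub[OF y] ray_down[OF y] \<open>t' \<in> y\<close> by blast
          then have "c = b"
            using spl(9)[OF ab _ y] step(1) \<open>b \<in> y\<close> by (auto simp: R_def)
          with step(2) show ?thesis by blast
        qed
      next
        assume "(t', a) \<in> R\<^sup>*"
        with step.hyps(2) show ?thesis by (blast intro: rtrancl_into_rtrancl)
      qed
    qed
  qed
  \<comment> \<open>A ray settled at \<open>t\<close> contains no node of \<open>S t\<close>, so no
    further \<open>R\<close>-step can stay on it.\<close>
  have below: "t = t'"
    if y: "y \<in> rays T r" and "(t, t') \<in> R\<^sup>*" "t' \<in> y" "y \<in> \<Union>(D t)" for y t t'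
    using that(2)
  proof (cases rule: converse_rtranclE)
    case (step s)
    have "s \<in> y"
      using R_le[OF step(2)] ray_sub[OF y] ray_down[OF y] \<open>t' \<in> y\<close> by blast
    then show ?thesis
      using spl(7)[OF _ y] step(1) \<open>y \<in> \<Union>(D t)\<close> by (auto simp: R_def)
  qed
  have "disjoint \<V>"
    unfolding disjoint_def
  proof (intro ballI impI)
    fix A B assume "A \<in> \<V>" "B \<in> \<V>" "A \<noteq> B"
    then obtain t t' where t: "t \<in> N" "A \<in> D t" "t' \<in> N" "B \<in> D t'"
      by (auto simp: \<V>_def)
    show "A \<inter> B = {}"
    proof (rule ccontr)
      assume "A \<inter> B \<noteq> {}"
      then obtain y where y: "y \<in> A" "y \<in> B"
        by blast
      then have yr: "y \<in> rays T r" "t \<in> y" "t' \<in> y"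
        using spl(2) t by (auto simp: mem_through subset_iff)
      \<comment> \<open>A common ray \<open>y\<close> makes \<open>t\<close> and \<open>t'\<close>
        comparable, and being settled at both forces equality; disjointness of \<open>D t\<close>
        then applies.\<close>
      have "t = t'"
        using comparable[OF yr(1) t(1,3) yr(2,3)] below[OF yr(1)] yr t y by blast
      then show False
        using spl(4)[of t] t y \<open>A \<noteq> B\<close> unfolding disjoint_def by blast
    qed
  qed
  moreover have "\<Union>\<V> = topspace (ray_space T r)"
    using covered spl(2) by (fastforce simp: \<V>_def topspace_ray_space mem_through)
  ultimately have "open_partition_of (ray_space T r) \<V>"
    using std standard_nonempty openin_standard
    by (auto simp: open_partition_of_def partition_on_def)
  moreover have "refines_cover \<V> \<U>"
    using spl(3) by (auto simp: refines_cover_def \<V>_def)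
  ultimately show ?thesis
    using std by blast
qed

end

theorem proposition2p15:
  fixes T :: "'a set" and r :: "'a rel"
  assumes "tree_on T r"
  shows "ultraparacompact_space (ray_space T r) \<and>
    (\<forall>\<U>. open_cover_of (ray_space T r) \<U> \<longrightarrow>
      (\<exists>\<V>. open_partition_of (ray_space T r) \<V> \<and> refines_cover \<V> \<U> \<and>
            (\<forall>V\<in>\<V>. standard_basic_open T r V)))"
proof -
  interpret order_tree T r
    using assms by (rule order_tree.intro)
  show ?thesis
    unfolding ultraparacompact_space_def using standard_refinement by blast
qed

end
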